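(* The sets $\mathcal{D}_{\mathrm{div}} = \{ x \in [0,1] : \sum_{n \in \mathbb{N}} 1/d_n(x) \text{ diverges} \}$ and $\mathcal{T}_{\mathrm{div}} = \{ x \in [0,1] : \sum_{n \in \mathbb{N}} T^n(x) \text{ diverges} \}$ are dense $G_\delta$, hence comeager and nonmeager, in $[0,1]$.
   Context: Pierce digits. For $x \in [0,1]$, define $d_1(x) := \lfloor 1/x \rfloor$ and $T(x) := 1 - d_1(x)\,x$ if $x \neq 0$, and $d_1(0) := \infty$, $T(0) := 0$. Here $\lfloor y \rfloor$ is the largest integer not exceeding $y$. For $n \in \mathbb{N} = \{1,2,3,\dots\}$ put $d_n(x) := d_1(T^{n-1}(x))$, where $T^{k}$ denotes the $k$-fold iterate of $T$ ($T^0$ is the identity). The sequence $(d_n(x))_{n \in \mathbb{N}}$ is the Pierce expansion digit sequence of $x$. Convention: $c/\infty := 0$ for $c \in \mathbb{R}$. A subset $A$ of a topological space $X$ is meager in $X$ if it is a countable union of nowhere dense subsets of $X$, nonmeager otherwise, and comeager in $X$ if $X \setminus A$ is meager in $X$. The interval $[0,1]$ carries the subspace topology induced by the standard topology of $\mathbb{R}$. *)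

theory Defs
  imports "HOL-Analysis.Analysis"
begin

section \<open>Pierce expansions\<close>

text \<open>The maps below are meant on \<open>[0,1]\<close> only; values at other reals are irrelevant.
  On \<open>(0,1]\<close> the floor of \<open>1/x\<close> is a positive integer, so the coercion \<^const>\<open>nat\<close> loses nothing.\<close>

definition pierce_d1 :: "real \<Rightarrow> enat" where
  "pierce_d1 x = (if x = 0 then \<infinity> else enat (nat \<lfloor>1 / x\<rfloor>))"

definition pierce_T :: "real \<Rightarrow> real" where
  "pierce_T x = (if x = 0 then 0 else 1 - real (the_enat (pierce_d1 x)) * x)"

text \<open>Digits are indexed by \<open>n \<ge> 1\<close>; the index \<open>0\<close> is not meaningful.\<close>

definition pierce_digit :: "nat \<Rightarrow> real \<Rightarrow> enat" where
  "pierce_digit n x = pierce_d1 ((pierce_T ^^ (n - 1)) x)"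

text \<open>Division of a real by a digit, with the convention \<open>c / \<infinity> = 0\<close>.\<close>

definition real_div_enat :: "real \<Rightarrow> enat \<Rightarrow> real" where
  "real_div_enat c d = (case d of enat k \<Rightarrow> c / real k | \<infinity> \<Rightarrow> 0)"

text \<open>Both series range over \<open>n = 1, 2, 3, \<dots>\<close>, hence the shift by \<^const>\<open>Suc\<close>.
  Divergence is the failure of convergence in \<^typ>\<open>real\<close>.\<close>

definition D_div :: "real set" where
  "D_div = {x \<in> {0..1}. \<not> summable (\<lambda>n. real_div_enat 1 (pierce_digit (Suc n) x))}"

definition T_div :: "real set" where
  "T_div = {x \<in> {0..1}. \<not> summable (\<lambda>n. (pierce_T ^^ Suc n) x)}"


section \<open>Baire category\<close>

definition nowhere_dense_in :: "'a topology \<Rightarrow> 'a set \<Rightarrow> bool" where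
  "nowhere_dense_in X A \<longleftrightarrow> A \<subseteq> topspace X \<and> X interior_of (X closure_of A) = {}"

definition meager_in :: "'a topology \<Rightarrow> 'a set \<Rightarrow> bool" where
  "meager_in X A \<longleftrightarrow> (\<exists>\<F>. countable \<F> \<and> (\<forall>N\<in>\<F>. nowhere_dense_in X N) \<and> A = \<Union>\<F>)"

definition nonmeager_in :: "'a topology \<Rightarrow> 'a set \<Rightarrow> bool" where
  "nonmeager_in X A \<longleftrightarrow> A \<subseteq> topspace X \<and> \<not> meager_in X A"

definition comeager_in :: "'a topology \<Rightarrow> 'a set \<Rightarrow> bool" where
  "comeager_in X A \<longleftrightarrow> A \<subseteq> topspace X \<and> meager_in X (topspace X - A)"

definition dense_in :: "'a topology \<Rightarrow> 'a set \<Rightarrow> bool" where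
  "dense_in X A \<longleftrightarrow> A \<subseteq> topspace X \<and> X closure_of A = topspace X"

end

theory Submission
  imports Defs
begin

text \<open>
  The two sets coincide. If \<open>x \<noteq> 0\<close> has first digit \<open>d\<close>, then \<open>1/d\<close> lies between \<open>x\<close> and \<open>2x\<close>;
  along an orbit this compares \<open>1/d\<^sub>n\<close> with \<open>T\<^sup>n\<^sup>-\<^sup>1 x\<close>, so the two series converge or diverge
  together (\<open>D_div_eq_T_div\<close>). Everything is therefore proved for \<open>T_div\<close>.

  \<^emph>\<open>The set is \<open>G\<^sub>\<delta>\<close>.\<close> The map \<open>T\<close> is discontinuous only at the points \<open>1/k\<close> (and at \<open>0\<close>), which it
  sends to \<open>0\<close>, and \<open>0\<close> is fixed. A divergent orbit never reaches \<open>0\<close>, so every iterate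
  \<open>T\<^sup>n\<close> is continuous at each point of \<open>T_div\<close>. Hence near such a point a large partial sum stays
  large, and \<open>T_div\<close> is the intersection over \<open>M\<close> of the interiors of the sets on which some
  partial sum exceeds \<open>M\<close> (\<open>T_div_eq_Inter_interior\<close>).

  \<^emph>\<open>The set is dense.\<close> The numbers \<open>y\<^sub>m = \<integral>\<^sub>0\<^sup>1 t\<^sup>m e\<^sup>t\<^sup>-\<^sup>1 dt\<close> satisfy
  \<open>y\<^sub>m\<^sub>+\<^sub>1 = 1 - (m+1) y\<^sub>m\<close> by partial integration, which is the Pierce map with the digit
  \<open>m+1\<close>. So \<open>y\<^sub>m\<close> has the digits \<open>m+1, m+2, m+3, \<dots>\<close>, whose reciprocals form a tail of the harmonic
  series, and \<open>T_div\<close> has points arbitrarily close to \<open>0\<close>. Membership in \<open>T_div\<close> depends only on the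
  tail of the orbit; so one may keep the first \<open>n\<close> digits of any \<open>x\<close> and replace the rest by
  such a tail (appending one if \<open>x\<close> has a finite expansion). The inverse branches \<open>y \<mapsto> (1-y)/d\<close>
  with \<open>d \<ge> 2\<close> contract at least by the factor \<open>2\<close>, and digits increase strictly, so the new point
  is close to \<open>x\<close> (\<open>T_div_approximates\<close>).

  Every dense \<open>G\<^sub>\<delta>\<close> is comeager, because its complement is a countable union of closed sets without
  interior; in a nonempty completely metrizable space the Baire category theorem makes it
  nonmeager as well (\<open>dense_gdelta_imp_comeager_nonmeager\<close>).
\<close>

section \<open>Dense \<open>G\<^sub>\<delta>\<close> sets in completely metrizable spaces\<close>

lemma dense_gdelta_imp_comeager:
  assumes dense: "dense_in X A" and gdelta: "gdelta_in X A"
  shows "comeager_in X A"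
proof -
  obtain C :: "nat \<Rightarrow> 'a set" where C: "\<And>n. openin X (C n)" "\<Inter>(range C) = A"
    using gdelta unfolding gdelta_in_descending by auto
  have "nowhere_dense_in X (topspace X - C n)" for n
  proof -
    have "X closure_of (C n) = topspace X"
      using dense C(2) closure_of_mono[of A "C n" X] closure_of_subset_topspace[of X "C n"]
      unfolding dense_in_def by auto
    moreover have "X closure_of (topspace X - C n) = topspace X - C n"
      using C(1) by (simp add: closure_of_closedin closedin_diff)
    ultimately show ?thesis
      unfolding nowhere_dense_in_def by (simp add: interior_of_complement)
  qed
  moreover have "topspace X - A = \<Union>(range (\<lambda>n. topspace X - C n))"
    using C(2) by auto
  ultimately have "meager_in X (topspace X - A)"
    unfolding meager_in_def by (intro exI[of _ "range (\<lambda>n. topspace X - C n)"]) auto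
  then show ?thesis
    using dense unfolding comeager_in_def dense_in_def by simp
qed

lemma completely_metrizable_not_meager:
  assumes "completely_metrizable_space X" and "topspace X \<noteq> {}"
  shows "\<not> meager_in X (topspace X)"
proof
  assume "meager_in X (topspace X)"
  then obtain F where F: "countable F" "\<And>N. N \<in> F \<Longrightarrow> nowhere_dense_in X N" "topspace X = \<Union>F"
    unfolding meager_in_def by auto
  have "X interior_of \<Union>((closure_of) X ` F) = {}"
  proof (rule Baire_category_alt)
    show "closedin X S \<and> X interior_of S = {}" if "S \<in> (closure_of) X ` F" for S
      using that F(2) unfolding nowhere_dense_in_def by auto
  qed (use assms F(1) in auto)
  moreover have "\<Union>((closure_of) X ` F) = topspace X"
  proof
    show "\<Union>((closure_of) X ` F) \<subseteq> topspace X"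
      by (simp add: UN_least closure_of_subset_topspace)
    show "topspace X \<subseteq> \<Union>((closure_of) X ` F)"
    proof
      fix x assume "x \<in> topspace X"
      then obtain N where N: "N \<in> F" "x \<in> N"
        using F(3) by auto
      then have "N \<subseteq> X closure_of N"
        using F(3) by (intro closure_of_subset) auto
      then show "x \<in> \<Union>((closure_of) X ` F)"
        using N by auto
    qed
  qed
  ultimately show False
    using assms(2) by simp
qed

lemma meager_in_Un:
  assumes "meager_in X A" and "meager_in X B"
  shows "meager_in X (A \<union> B)"
proof -
  obtain F G where "countable F" "\<forall>N\<in>F. nowhere_dense_in X N" "A = \<Union>F"
    and "countable G" "\<forall>N\<in>G. nowhere_dense_in X N" "B = \<Union>G"
    using assms unfolding meager_in_def by auto
  then show ?thesis
    unfolding meager_in_def by (intro exI[of _ "F \<union> G"]) auto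
qed

text \<open>If the set were meager too, the whole space would be the union of two meager sets, which the
  Baire category theorem forbids.\<close>

lemma dense_gdelta_imp_comeager_nonmeager:
  assumes "completely_metrizable_space X" "topspace X \<noteq> {}"
    and "dense_in X A" "gdelta_in X A"
  shows "comeager_in X A" "nonmeager_in X A"
proof -
  show comeager: "comeager_in X A"
    using assms(3,4) by (rule dense_gdelta_imp_comeager)
  have "\<not> meager_in X A"
  proof
    assume "meager_in X A"
    then have "meager_in X (A \<union> (topspace X - A))"
      using comeager unfolding comeager_in_def by (intro meager_in_Un) auto
    moreover have "A \<union> (topspace X - A) = topspace X"
      using assms(3) unfolding dense_in_def by auto
    ultimately show False
      using completely_metrizable_not_meager[OF assms(1,2)] by simp
  qed
  then show "nonmeager_in X A"
    using assms(3) unfolding nonmeager_in_def dense_in_def by simp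
qed

section \<open>The Pierce map\<close>

lemma pierce_T_0 [simp]: "pierce_T 0 = 0"
  by (simp add: pierce_T_def)

lemma pierce_T_pos: "pierce_T x = 1 - of_int \<lfloor>1 / x\<rfloor> * x" if "x > 0"
  using that by (simp add: pierce_T_def pierce_d1_def)

text \<open>A point with first digit \<open>k\<close> lies in \<open>(1/(k+1), 1/k]\<close>, and \<open>T\<close> maps this interval linearly
  onto \<open>[0, 1/(k+1))\<close>.\<close>

lemma first_digit_cases:
  assumes "0 < x" "x \<le> 1"
  obtains k :: nat where "k \<ge> 1" "\<lfloor>1 / x\<rfloor> = int k" "real k * x \<le> 1" "1 < (real k + 1) * x"
    "pierce_T x = 1 - real k * x" "0 \<le> pierce_T x" "pierce_T x < 1 / (real k + 1)"
proof -
  define k where "k = nat \<lfloor>1 / x\<rfloor>"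
  have "1 \<le> 1 / x"
    using assms by simp
  then have "1 \<le> \<lfloor>1 / x\<rfloor>"
    by (simp only: one_le_floor)
  then have k: "k \<ge> 1" "\<lfloor>1 / x\<rfloor> = int k"
    unfolding k_def by (simp_all only: le_nat_iff nat_0_le of_nat_1)
  have "real k \<le> 1 / x" "1 / x < real k + 1"
    using k(2) by linarith+
  then have bounds: "real k * x \<le> 1" "1 < (real k + 1) * x"
    using assms by (simp_all add: field_simps)
  moreover have T: "pierce_T x = 1 - real k * x"
    using assms k by (simp add: pierce_T_pos)
  moreover have "(real k + 1) * (1 - real k * x) < 1"
  proof -
    have "real k * 1 < real k * ((real k + 1) * x)"
      using bounds(2) k(1) by (intro mult_strict_left_mono) auto
    then show ?thesis
      by (simp add: algebra_simps)
  qed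
  then have "pierce_T x < 1 / (real k + 1)"
    unfolding T by (simp add: pos_less_divide_eq mult.commute)
  ultimately show ?thesis
    using that k by simp
qed

lemma pierce_T_unit_interval: "pierce_T x \<in> {0..1}" if "x \<in> {0..1}"
proof (cases "x = 0")
  case False
  then have "0 < x" "x \<le> 1"
    using that by auto
  then show ?thesis
    by (rule first_digit_cases) (use \<open>0 < x\<close> in auto)
qed simp

lemma pierce_T_iterate_unit_interval: "(pierce_T ^^ n) x \<in> {0..1}" if "x \<in> {0..1}"
  by (induction n) (use that pierce_T_unit_interval in auto)

lemma pierce_T_inverse_branch:
  assumes "d \<ge> 1" "0 \<le> y" "y < 1 / (real d + 1)"
  shows "pierce_T ((1 - y) / real d) = y"
proof -
  have y: "(real d + 1) * y < 1"
    using assms by (simp add: field_simps)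
  have "y < 1"
    using assms(2,3) y by (smt (verit) mult_le_cancel_right1 of_nat_0_le_iff)
  have "real d \<le> real d / (1 - y)" "real d / (1 - y) < real d + 1"
    using \<open>y < 1\<close> assms(2) y by (simp_all add: field_simps)
  then have "\<lfloor>real d / (1 - y)\<rfloor> = int d"
    by linarith
  then show ?thesis
    using \<open>y < 1\<close> assms(1) by (subst pierce_T_pos) auto
qed

section \<open>The two divergence sets\<close>

lemma T_div_iff: "x \<in> T_div \<longleftrightarrow> x \<in> {0..1} \<and> \<not> summable (\<lambda>n. (pierce_T ^^ n) x)"
  unfolding T_div_def using summable_Suc_iff[of "\<lambda>n. (pierce_T ^^ n) x"] by simp

lemma reciprocal_digit_bounds:
  assumes "t \<in> {0..1}"
  shows "t \<le> real_div_enat 1 (pierce_d1 t)" "real_div_enat 1 (pierce_d1 t) \<le> 2 * t"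
proof -
  have "t \<le> real_div_enat 1 (pierce_d1 t) \<and> real_div_enat 1 (pierce_d1 t) \<le> 2 * t"
  proof (cases "t = 0")
    case True
    then show ?thesis
      by (simp add: real_div_enat_def pierce_d1_def)
  next
    case False
    then have "0 < t" "t \<le> 1"
      using assms by auto
    then obtain k :: nat where k: "k \<ge> 1" "\<lfloor>1 / t\<rfloor> = int k" "real k * t \<le> 1"
        "1 < (real k + 1) * t"
      by (rule first_digit_cases)
    have "(real k + 1) * t \<le> (2 * real k) * t"
      using k(1) \<open>0 < t\<close> by (intro mult_right_mono) auto
    then have "1 \<le> real k * (2 * t)"
      using k(4) by simp
    then show ?thesis
      using k False by (simp add: real_div_enat_def pierce_d1_def field_simps)
  qed
  then show "t \<le> real_div_enat 1 (pierce_d1 t)" "real_div_enat 1 (pierce_d1 t) \<le> 2 * t"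
    by auto
qed

lemma D_div_eq_T_div: "D_div = T_div"
proof -
  have "summable (\<lambda>n. real_div_enat 1 (pierce_digit (Suc n) x)) \<longleftrightarrow>
        summable (\<lambda>n. (pierce_T ^^ n) x)" if "x \<in> {0..1}" for x
  proof -
    note bounds = reciprocal_digit_bounds[OF pierce_T_iterate_unit_interval[OF that]]
    have nonneg: "0 \<le> (pierce_T ^^ n) x" for n
      using pierce_T_iterate_unit_interval[OF that, of n] by simp
    show ?thesis
      unfolding pierce_digit_def diff_Suc_1
    proof
      assume "summable (\<lambda>n. real_div_enat 1 (pierce_d1 ((pierce_T ^^ n) x)))"
      then show "summable (\<lambda>n. (pierce_T ^^ n) x)"
        by (rule summable_comparison_test') (use bounds(1) nonneg in simp)
    next
      assume "summable (\<lambda>n. (pierce_T ^^ n) x)"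
      then have "summable (\<lambda>n. 2 * (pierce_T ^^ n) x)"
        by (rule summable_mult)
      moreover have "norm (real_div_enat 1 (pierce_d1 ((pierce_T ^^ n) x))) \<le> 2 * (pierce_T ^^ n) x" for n
        using bounds[of n] nonneg[of n] by simp
      ultimately show "summable (\<lambda>n. real_div_enat 1 (pierce_d1 ((pierce_T ^^ n) x)))"
        by (rule summable_comparison_test')
    qed
  qed
  then show ?thesis
    unfolding D_div_def set_eq_iff mem_Collect_eq T_div_iff by blast
qed

lemma T_div_tail_invariant: "x \<in> T_div \<longleftrightarrow> pierce_T x \<in> T_div" if "x \<in> {0..1}"
proof -
  have "(\<lambda>n. (pierce_T ^^ n) (pierce_T x)) = (\<lambda>n. (pierce_T ^^ Suc n) x)"
    by (simp only: funpow_Suc_right comp_apply)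
  then show ?thesis
    using that pierce_T_unit_interval[OF that] summable_Suc_iff[of "\<lambda>n. (pierce_T ^^ n) x"]
    unfolding T_div_iff by metis
qed

section \<open>Divergence is a \<open>G\<^sub>\<delta>\<close> condition\<close>

lemma isCont_pierce_T:
  assumes "0 < x" "pierce_T x \<noteq> 0"
  shows "isCont pierce_T x"
proof -
  \<comment> \<open>The floor jumps only where \<open>1/x\<close> is an integer, and there \<open>T\<close> vanishes.\<close>
  have "1 / x \<notin> \<int>"
  proof
    assume "1 / x \<in> \<int>"
    then obtain k where "1 / x = of_int k"
      by (auto elim: Ints_cases)
    then have "of_int \<lfloor>1 / x\<rfloor> = 1 / x"
      by (simp only: floor_of_int)
    then have "of_int \<lfloor>1 / x\<rfloor> * x = 1"
      using assms(1) by (simp only:) simp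
    then show False
      using assms by (simp add: pierce_T_pos)
  qed
  then have "((\<lambda>z. 1 - of_int \<lfloor>1 / z\<rfloor> * z) \<longlongrightarrow> 1 - of_int \<lfloor>1 / x\<rfloor> * x) (at x)"
    using assms by (intro tendsto_intros tendsto_of_int_floor) auto
  moreover have "\<forall>\<^sub>F z in at x. 1 - of_int \<lfloor>1 / z\<rfloor> * z = pierce_T z"
    using order_tendstoD(1)[OF tendsto_ident_at assms(1), of UNIV]
    by eventually_elim (simp add: pierce_T_pos)
  ultimately show ?thesis
    using assms unfolding isCont_def
    by (simp add: pierce_T_pos tendsto_cong)
qed

lemma T_div_orbit_nonzero:
  assumes "x \<in> T_div"
  shows "(pierce_T ^^ n) x \<noteq> 0"
proof
  assume zero: "(pierce_T ^^ n) x = 0"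
  have "(pierce_T ^^ (m + n)) x = 0" for m
    by (induction m) (use zero in auto)
  then have "summable (\<lambda>m. (pierce_T ^^ (m + n)) x)"
    by simp
  then show False
    using assms summable_iff_shift[of "\<lambda>m. (pierce_T ^^ m) x" n] by (simp add: T_div_iff)
qed

lemma isCont_pierce_T_iterate:
  assumes "x \<in> T_div"
  shows "isCont (pierce_T ^^ n) x"
proof (induction n)
  case (Suc n)
  have "(pierce_T ^^ n) x > 0"
    using T_div_orbit_nonzero[OF assms, of n] pierce_T_iterate_unit_interval[of x n] assms
    by (simp add: T_div_iff less_le)
  moreover have "pierce_T ((pierce_T ^^ n) x) \<noteq> 0"
    using T_div_orbit_nonzero[OF assms, of "Suc n"] by simp
  ultimately have "isCont pierce_T ((pierce_T ^^ n) x)"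
    by (rule isCont_pierce_T)
  then show ?case
    using isCont_o2[OF Suc] by (simp add: comp_def)
qed (simp add: id_def)

text \<open>Passing to interiors loses no point of \<open>T_div\<close>, since partial sums are continuous
  there. Conversely, unbounded partial sums already force divergence.\<close>

lemma T_div_eq_Inter_interior:
  "T_div = (\<Inter>M::nat. interior {x. \<exists>N. (\<Sum>n\<le>N. (pierce_T ^^ n) x) > real M}) \<inter> {0..1}"
    (is "_ = (\<Inter>M. interior (?E M)) \<inter> _")
proof (intro equalityI subsetI)
  fix x assume x: "x \<in> T_div"
  then have x01: "x \<in> {0..1}"
    by (simp add: T_div_iff)
  have "x \<in> interior (?E M)" for M
  proof -
    have "\<exists>N. (\<Sum>n\<le>N. (pierce_T ^^ n) x) > real M"
    proof (rule ccontr)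
      assume "\<not> ?thesis"
      then have "summable (\<lambda>n. (pierce_T ^^ n) x)"
        using pierce_T_iterate_unit_interval[OF x01]
        by (intro bounded_imp_summable[where B = "real M"]) (auto simp: not_less)
      with x show False
        by (simp add: T_div_iff)
    qed
    then obtain N where N: "(\<Sum>n\<le>N. (pierce_T ^^ n) x) > real M" ..
    have "isCont (\<lambda>z. \<Sum>n\<le>N. (pierce_T ^^ n) z) x"
      by (intro continuous_sum isCont_pierce_T_iterate[OF x])
    then have "\<forall>\<^sub>F z in at x. real M < (\<Sum>n\<le>N. (pierce_T ^^ n) z)"
      using N unfolding isCont_def by (rule order_tendstoD(1))
    then have "\<forall>\<^sub>F z in nhds x. real M < (\<Sum>n\<le>N. (pierce_T ^^ n) z)"
      using N by (simp add: eventually_nhds_conv_at)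
    then obtain S where "open S" "x \<in> S" "\<forall>z\<in>S. real M < (\<Sum>n\<le>N. (pierce_T ^^ n) z)"
      unfolding eventually_nhds by auto
    then show ?thesis
      by (intro interiorI[of S]) auto
  qed
  then show "x \<in> (\<Inter>M. interior (?E M)) \<inter> {0..1}"
    using x01 by auto
next
  fix x assume "x \<in> (\<Inter>M. interior (?E M)) \<inter> {0..1}"
  then have x01: "x \<in> {0..1}" and large: "\<exists>N. (\<Sum>n\<le>N. (pierce_T ^^ n) x) > real M" for M
    using interior_subset[of "?E M" for M] by blast+
  have "\<not> summable (\<lambda>n. (pierce_T ^^ n) x)"
  proof
    assume "summable (\<lambda>n. (pierce_T ^^ n) x)"
    then have "(\<Sum>n\<le>N. (pierce_T ^^ n) x) \<le> (\<Sum>n. (pierce_T ^^ n) x)" for N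
      using pierce_T_iterate_unit_interval[OF x01] by (intro sum_le_suminf) auto
    moreover obtain M :: nat where "(\<Sum>n. (pierce_T ^^ n) x) \<le> real M"
      using real_arch_simple by blast
    ultimately show False
      using large[of M] by (meson le_less_trans not_le)
  qed
  then show "x \<in> T_div"
    using x01 by (simp add: T_div_iff)
qed

lemma gdelta_in_T_div: "gdelta_in (top_of_set {0..1}) T_div"
proof -
  have "gdelta_in euclidean (\<Inter>M::nat. interior {x. \<exists>N. (\<Sum>n\<le>N. (pierce_T ^^ n) x) > real M})"
    by (intro gdelta_in_Inter) (auto intro: open_imp_gdelta_in)
  then show ?thesis
    unfolding gdelta_in_subtopology using T_div_eq_Inter_interior by blast
qed

section \<open>Points with consecutive digits\<close>

text \<open>For \<open>m = 0\<close> this is \<open>1 - 1/e\<close>, the number with Pierce digits \<open>1, 2, 3, \<dots>\<close>; the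
  subsequent values form its orbit.\<close>

definition exp_moment :: "nat \<Rightarrow> real" where
  "exp_moment m = integral {0..1} (\<lambda>t. t ^ m * exp (t - 1))"

lemma exp_moment_integrable: "(\<lambda>t::real. t ^ m * exp (t - 1)) integrable_on {0..1}"
  by (intro integrable_continuous_real continuous_intros)

lemma exp_moment_Suc: "exp_moment (Suc m) = 1 - real (Suc m) * exp_moment m"
proof -
  have "((\<lambda>t::real. real (Suc m) * (t ^ m * exp (t - 1)) + t ^ Suc m * exp (t - 1)) has_integral
      1 ^ Suc m * exp (1 - 1) - 0 ^ Suc m * exp (0 - 1)) {0..1}"
  proof (rule fundamental_theorem_of_calculus)
    fix x :: real
    have "((\<lambda>t. t ^ Suc m * exp (t - 1)) has_real_derivative
        real (Suc m) * (x ^ m * exp (x - 1)) + x ^ Suc m * exp (x - 1)) (at x within {0..1})"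
      by (rule derivative_eq_intros refl)+ (simp del: power_Suc)
    then show "((\<lambda>t. t ^ Suc m * exp (t - 1)) has_vector_derivative
        real (Suc m) * (x ^ m * exp (x - 1)) + x ^ Suc m * exp (x - 1)) (at x within {0..1})"
      by (simp only: has_real_derivative_iff_has_vector_derivative)
  qed simp
  moreover have "((\<lambda>t::real. real (Suc m) * (t ^ m * exp (t - 1)) + t ^ Suc m * exp (t - 1)) has_integral
      real (Suc m) * exp_moment m + exp_moment (Suc m)) {0..1}"
    unfolding exp_moment_def
    by (rule has_integral_add[OF has_integral_mult_right[OF integrable_integral[OF exp_moment_integrable]]
          integrable_integral[OF exp_moment_integrable]])
  ultimately have "real (Suc m) * exp_moment m + exp_moment (Suc m) = 1"
    by (auto dest: has_integral_unique)
  then show ?thesis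
    by simp
qed

lemma exp_moment_nonneg: "0 \<le> exp_moment m"
  unfolding exp_moment_def by (intro integral_nonneg exp_moment_integrable) auto

lemma exp_moment_le: "exp_moment m \<le> 1 / (real m + 1)"
  using exp_moment_Suc[of m] exp_moment_nonneg[of "Suc m"] by (simp add: field_simps)

text \<open>Equality in either bound would, by the recursion, force one of the next two moments to equal
  \<open>1\<close>, which is above its upper bound.\<close>

lemma exp_moment_pos: "0 < exp_moment m"
proof -
  have "exp_moment m \<noteq> 0"
    using exp_moment_Suc[of m] exp_moment_le[of "Suc m"] by auto
  then show ?thesis
    using exp_moment_nonneg[of m] by simp
qed

lemma exp_moment_less: "exp_moment m < 1 / (real m + 1)"
  using exp_moment_Suc[of m] exp_moment_pos[of "Suc m"] by (simp add: field_simps)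

lemma pierce_T_exp_moment: "pierce_T (exp_moment m) = exp_moment (Suc m)"
proof -
  have "exp_moment m = (1 - exp_moment (Suc m)) / real (Suc m)"
    using exp_moment_Suc[of m] by (simp add: field_simps)
  moreover have "pierce_T ((1 - exp_moment (Suc m)) / real (Suc m)) = exp_moment (Suc m)"
    using exp_moment_pos[of "Suc m"] exp_moment_less[of "Suc m"]
    by (intro pierce_T_inverse_branch) auto
  ultimately show ?thesis
    by simp
qed

lemma exp_moment_in_T_div: "exp_moment m \<in> T_div"
proof -
  have orbit: "(pierce_T ^^ n) (exp_moment m) = exp_moment (n + m)" for n
    by (induction n) (simp_all add: pierce_T_exp_moment)
  have "\<not> summable (\<lambda>n. exp_moment (n + m))"
  proof
    assume "summable (\<lambda>n. exp_moment (n + m))"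
    then have "summable exp_moment"
      by simp
    moreover have "norm (inverse (real (n + 2))) \<le> exp_moment n" for n
    proof -
      \<comment> \<open>The upper bound on the next moment is a lower bound on this one.\<close>
      have "1 - (real n + 1) * exp_moment n \<le> 1 / (real n + 2)"
        using exp_moment_Suc[of n] exp_moment_le[of "Suc n"] by (simp add: add.commute)
      then have "(real n + 1) * (1 / (real n + 2)) \<le> (real n + 1) * exp_moment n"
        by (simp add: field_simps)
      then have "1 / (real n + 2) \<le> exp_moment n"
        by (rule mult_left_le_imp_le) simp
      then show ?thesis
        by (simp add: inverse_eq_divide add.commute)
    qed
    ultimately have "summable (\<lambda>n. inverse (real (n + 2)))"
      by (rule summable_comparison_test')
    then have "summable (\<lambda>n. inverse (real n))"
      by (subst (asm) summable_iff_shift)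
    then show False
      using not_summable_harmonic by blast
  qed
  moreover have "exp_moment m \<le> 1"
    by (rule order_trans[OF exp_moment_le]) simp
  ultimately show ?thesis
    using exp_moment_nonneg[of m] by (simp add: T_div_iff orbit)
qed

section \<open>Density\<close>

text \<open>Induction on the number \<open>n\<close> of digits that are kept: approximate \<open>T x\<close>, then pull back
  along the inverse branch of the first digit \<open>k\<close> of \<open>x\<close>. The bound \<open>y < 1/d\<close> is
  needed because the approximant of \<open>T x\<close> must lie in the domain \<open>[0, 1/(k+1))\<close> of that branch;
  positivity of that approximant makes the bound strict again for its preimage. If the orbit
  reaches \<open>0\<close> early, a point with large consecutive digits takes its place. The factor \<open>1/d\<close> in the error makes the induction work even for \<open>k = 1\<close>, where the branch does not
  contract, as the next digit is at least \<open>2\<close>.\<close>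

lemma T_div_approximates:
  assumes "d \<ge> 1" "0 \<le> x" "x \<le> 1 / real d"
  shows "\<exists>y\<in>T_div. 0 < y \<and> y < 1 / real d \<and> \<bar>x - y\<bar> \<le> 1 / (real d * 2 ^ n)"
  using assms
proof (induction n arbitrary: d x)
  case 0
  have "exp_moment d < 1 / real d"
    using exp_moment_less[of d] 0 by (smt (verit) frac_less2 of_nat_le_0_iff of_nat_1_eq_iff of_nat_mono)
  then show ?case
    using 0 exp_moment_pos[of d]
    by (intro bexI[OF _ exp_moment_in_T_div[of d]]) auto
next
  case (Suc n)
  show ?case
  proof (cases "x = 0")
    case True
    define m where "m = d * 2 ^ Suc n"
    have "d \<le> m"
      unfolding m_def by simp
    then have "1 / (real m + 1) < 1 / real m" "1 / real m \<le> 1 / real d"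
      using Suc.prems(1) by (auto intro!: divide_strict_left_mono divide_left_mono)
    moreover have "1 / real m = 1 / (real d * 2 ^ Suc n)"
      unfolding m_def by simp
    ultimately show ?thesis
      using True exp_moment_pos[of m] exp_moment_less[of m]
      by (intro bexI[OF _ exp_moment_in_T_div[of m]]) auto
  next
    case False
    have "1 / real d \<le> 1"
      using Suc.prems(1) by simp
    then have x: "0 < x" "x \<le> 1"
      using False Suc.prems by linarith+
    then obtain k :: nat where k: "k \<ge> 1" "1 < (real k + 1) * x"
      "pierce_T x = 1 - real k * x" "0 \<le> pierce_T x" "pierce_T x < 1 / (real k + 1)"
      by (rule first_digit_cases)
    have "real d \<le> 1 / x"
      using x Suc.prems by (simp add: field_simps)
    also have "1 / x < real k + 1"
      using k(2) x by (simp add: field_simps)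
    finally have "d \<le> k"
      by linarith
    obtain z where z: "z \<in> T_div" "0 < z" "z < 1 / (real k + 1)"
      "\<bar>pierce_T x - z\<bar> \<le> 1 / ((real k + 1) * 2 ^ n)"
      using Suc.IH[of "Suc k" "pierce_T x"] k by (auto simp: add.commute)
    define y where "y = (1 - z) / real k"
    have "1 / (real k + 1) \<le> 1"
      by simp
    then have "z < 1"
      using z(3) by linarith
    have "0 < y"
      using \<open>z < 1\<close> k(1) by (simp add: y_def)
    have "y < 1 / real k"
      using z(2) k(1) by (simp add: y_def divide_strict_right_mono)
    also have "1 / real k \<le> 1 / real d"
      using \<open>d \<le> k\<close> Suc.prems(1) by (intro divide_left_mono) auto
    finally have "y < 1 / real d" .
    have "pierce_T y = z"
      unfolding y_def using k(1) z by (intro pierce_T_inverse_branch) auto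
    then have "y \<in> T_div"
      using T_div_tail_invariant[of y] z(1) \<open>0 < y\<close> \<open>y < 1 / real d\<close> \<open>1 / real d \<le> 1\<close> by simp
    have "x - y = (z - pierce_T x) / real k"
      using k(1,3) by (simp add: y_def field_simps)
    then have "\<bar>x - y\<bar> = \<bar>pierce_T x - z\<bar> / real k"
      by (simp add: abs_minus_commute)
    also have "\<dots> \<le> 1 / ((real k + 1) * 2 ^ n) / real k"
      using z(4) by (intro divide_right_mono) auto
    also have "\<dots> = 1 / ((real k * (real k + 1)) * 2 ^ n)"
      by (simp add: mult_ac)
    also have "\<dots> \<le> 1 / ((real d * 2) * 2 ^ n)"
      using \<open>d \<le> k\<close> k(1) Suc.prems(1)
      by (intro divide_left_mono mult_right_mono mult_mono) auto
    finally have "\<bar>x - y\<bar> \<le> 1 / (real d * 2 ^ Suc n)"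
      by (simp add: mult_ac)
    then show ?thesis
      using \<open>y \<in> T_div\<close> \<open>0 < y\<close> \<open>y < 1 / real d\<close> by blast
  qed
qed

lemma dense_in_T_div: "dense_in (top_of_set {0..1}) T_div"
proof -
  have sub: "T_div \<subseteq> {0..1}"
    by (auto simp: T_div_iff)
  have "x \<in> closure T_div" if "x \<in> {0..1}" for x
    unfolding closure_approachable
  proof (intro allI impI)
    fix e :: real assume "e > 0"
    then obtain n where n: "(1 / 2) ^ n < e"
      using real_arch_pow_inv[of e "1 / 2"] by auto
    obtain y where "y \<in> T_div" "\<bar>x - y\<bar> \<le> 1 / 2 ^ n"
      using T_div_approximates[of 1 x n] \<open>x \<in> {0..1}\<close> by auto
    then show "\<exists>y\<in>T_div. dist y x < e"
      using n by (intro bexI[of _ y]) (auto simp: dist_real_def power_divide)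
  qed
  then have "{0..1} \<inter> closure T_div = {0..1}"
    by auto
  then show ?thesis
    using sub by (simp add: dense_in_def closure_of_subtopology Int_absorb1)
qed

theorem corollary1p16:
  shows "(dense_in (top_of_set {0..1}) D_div \<and> gdelta_in (top_of_set {0..1}) D_div \<and>
          comeager_in (top_of_set {0..1}) D_div \<and> nonmeager_in (top_of_set {0..1}) D_div) \<and>
         (dense_in (top_of_set {0..1}) T_div \<and> gdelta_in (top_of_set {0..1}) T_div \<and>
          comeager_in (top_of_set {0..1}) T_div \<and> nonmeager_in (top_of_set {0..1}) T_div)"
proof -
  have "completely_metrizable_space (top_of_set {0..1::real})"
    using completely_metrizable_space_cbox[of "0::real" 1] by simp
  moreover have "topspace (top_of_set {0..1::real}) \<noteq> {}"
    by simp
  ultimately have "comeager_in (top_of_set {0..1}) T_div" "nonmeager_in (top_of_set {0..1}) T_div"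
    using dense_gdelta_imp_comeager_nonmeager dense_in_T_div gdelta_in_T_div by blast+
  then show ?thesis
    using dense_in_T_div gdelta_in_T_div by (simp add: D_div_eq_T_div)
qed

end
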